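(* Let $B_W(\cdot)$ be a $W$-Brownian motion (in law) on $[0,1]$. For $s,t\in[0,1]$ with $s\le t$ let $T_{s,t}:L^\infty(\mathbb{R})\to L^\infty(\mathbb{R})$ be given by $$(T_{s,t}f)(x):=E\big(f(x+B_W(t)-B_W(s))\big).$$ Then the family $(T_{s,t})_{0\le s\le t\le1}$ is a two-parameter Markov semigroup on $[0,1]$.
   Context: $W:\mathbb{R}\to\mathbb{R}$ is strictly increasing and càdlàg (right-continuous with left limits), with $W(x+1)-W(x)=W(1)-W(0)$ for all $x$, continuous at $0$ and $W(0)=0$; it may otherwise have jumps. The $W$-Brownian bridge $B_{W,0}=(B_{W,0}(t))_{t\in[0,1]}$ is the centered Gaussian process with covariance $\varrho_{W,0}(t,s)=W(t\wedge s)-\frac{W(t)W(s)}{W(1)}$. A $W$-Brownian motion (in law) on $[0,1]$ is the process $B_W(t)=B_{W,0}(t)+\frac{W(t)}{W(1)}B_1$, where $B_{W,0}$ is a $W$-Brownian bridge and $B_1\sim N(0,W(1))$ is independent of $\sigma(B_{W,0}(t):t\in[0,1])$. A family $(T_{s,t})_{s\le t}$ of bounded linear operators on $L^\infty(\mathbb{R})$, indexed by $s\le t$ in $[0,1]$, is a two-parameter Markov semigroup if for all $s\le u\le t$: (1) $T_{s,s}=I$; (2) $T_{s,t}1=1$; (3) $f\in L^\infty(\mathbb{R})$, $f\ge0$ imply $T_{s,t}f\ge0$; (4) $T_{s,t}=T_{s,u}T_{u,t}$. *)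

theory Defs
  imports "HOL-Probability.Probability"
begin

section \<open>The Banach space of essentially bounded functions on the real line\<close>

text \<open>
  Functions are taken Borel measurable, so that composing one with a random variable is again
  measurable.  Every Lebesgue measurable function agrees almost everywhere with a Borel measurable
  one, so the classes modulo Lebesgue null sets are the usual ones.
\<close>

definition ess_bounded :: "(real \<Rightarrow> real) set" where
  "ess_bounded = {f \<in> borel_measurable borel. \<exists>C. AE x in lborel. \<bar>f x\<bar> \<le> C}"

definition ess_eq :: "(real \<Rightarrow> real) \<Rightarrow> (real \<Rightarrow> real) \<Rightarrow> bool" where
  "ess_eq f g \<longleftrightarrow> f \<in> ess_bounded \<and> g \<in> ess_bounded \<and> (AE x in lborel. f x = g x)"

definition ess_norm :: "(real \<Rightarrow> real) \<Rightarrow> real" where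
  "ess_norm f = real_of_ereal (esssup lborel (\<lambda>x. ereal \<bar>f x\<bar>))"

lemma ess_boundedI:
  "f \<in> borel_measurable borel \<Longrightarrow> AE x in lborel. \<bar>f x\<bar> \<le> C \<Longrightarrow> f \<in> ess_bounded"
  by (auto simp: ess_bounded_def)

lemma ess_bounded_measurable [measurable_dest]: "f \<in> ess_bounded \<Longrightarrow> f \<in> borel_measurable borel"
  by (simp add: ess_bounded_def)

lemma ess_boundedE:
  assumes "f \<in> ess_bounded"
  obtains C where "AE x in lborel. \<bar>f x\<bar> \<le> C"
  using assms by (auto simp: ess_bounded_def)

lemma ess_bounded_const: "(\<lambda>_. c) \<in> ess_bounded"
  by (rule ess_boundedI[where C = "\<bar>c\<bar>"]) auto

lemma ess_bounded_add:
  assumes "f \<in> ess_bounded" "g \<in> ess_bounded"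
  shows "(\<lambda>x. f x + g x) \<in> ess_bounded"
proof -
  obtain C D where "AE x in lborel. \<bar>f x\<bar> \<le> C" "AE x in lborel. \<bar>g x\<bar> \<le> D"
    using assms by (auto simp: ess_bounded_def)
  then have "AE x in lborel. \<bar>f x + g x\<bar> \<le> C + D"
    by eventually_elim linarith
  moreover have "(\<lambda>x. f x + g x) \<in> borel_measurable borel"
    using assms[THEN ess_bounded_measurable] by simp
  ultimately show ?thesis by (rule ess_boundedI[rotated])
qed

lemma ess_bounded_scale:
  assumes "f \<in> ess_bounded"
  shows "(\<lambda>x. c * f x) \<in> ess_bounded"
proof -
  obtain C where "AE x in lborel. \<bar>f x\<bar> \<le> C"
    using assms by (auto simp: ess_bounded_def)
  then have "AE x in lborel. \<bar>c * f x\<bar> \<le> \<bar>c\<bar> * C"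
    by eventually_elim (simp add: abs_mult mult_left_mono)
  moreover have "(\<lambda>x. c * f x) \<in> borel_measurable borel"
    using assms[THEN ess_bounded_measurable] by simp
  ultimately show ?thesis by (rule ess_boundedI[rotated])
qed

lemma ess_bounded_uminus: "f \<in> ess_bounded \<Longrightarrow> (\<lambda>x. - f x) \<in> ess_bounded"
  using ess_bounded_scale[of f "-1"] by simp

lemma ess_bounded_diff:
  "f \<in> ess_bounded \<Longrightarrow> g \<in> ess_bounded \<Longrightarrow> (\<lambda>x. f x - g x) \<in> ess_bounded"
  using ess_bounded_add[of f "\<lambda>x. - g x"] ess_bounded_uminus[of g] by simp

lemma AE_lborel_nonneg_const:
  assumes "AE x::real in lborel. \<bar>f x :: real\<bar> \<le> C"
  shows "0 \<le> C"
proof (rule ccontr)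
  assume "\<not> 0 \<le> C"
  with assms have "AE x::real in lborel. False"
    by (auto elim!: eventually_mono)
  then show False
    by (simp add: eventually_False ae_filter_eq_bot_iff)
qed

lemma
  assumes "f \<in> ess_bounded"
  shows ess_norm_AE: "AE x in lborel. \<bar>f x\<bar> \<le> ess_norm f"
    and ess_norm_nonneg: "0 \<le> ess_norm f"
    and ess_norm_least: "\<And>C. AE x in lborel. \<bar>f x\<bar> \<le> C \<Longrightarrow> ess_norm f \<le> C"
proof -
  let ?E = "esssup lborel (\<lambda>x. ereal \<bar>f x\<bar>)"
  have meas: "(\<lambda>x. ereal \<bar>f x\<bar>) \<in> borel_measurable lborel"
    using ess_bounded_measurable[OF assms] by simp
  have le: "?E \<le> ereal C" if "AE x in lborel. \<bar>f x\<bar> \<le> C" for C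
    using that by (intro esssup_I meas) auto
  have "esssup lborel (\<lambda>x::real. 0::ereal) \<le> ?E"
    by (rule esssup_mono) auto
  then have nonneg: "0 \<le> ?E"
    by (simp add: esssup_const)
  obtain C where "AE x in lborel. \<bar>f x\<bar> \<le> C"
    using assms by (rule ess_boundedE)
  then have "?E \<le> ereal C" by (rule le)
  with nonneg have fin: "\<bar>?E\<bar> \<noteq> \<infinity>" by (cases ?E) auto
  then have eq: "?E = ereal (ess_norm f)"
    by (simp add: ess_norm_def ereal_real)
  show "AE x in lborel. \<bar>f x\<bar> \<le> ess_norm f"
    using esssup_AE[of "\<lambda>x. ereal \<bar>f x\<bar>" lborel] unfolding eq by simp
  show "0 \<le> ess_norm f"
    using nonneg by (simp add: eq)
  show "ess_norm f \<le> C" if "AE x in lborel. \<bar>f x\<bar> \<le> C" for C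
    using le[OF that] by (simp add: eq)
qed

quotient_type linfty = "real \<Rightarrow> real" / partial: ess_eq
  morphisms rep_linfty Linfty
proof (rule part_equivpI)
  show "\<exists>f. ess_eq f f"
    using ess_bounded_const[of 0] by (auto simp: ess_eq_def)
  show "symp ess_eq"
    by (auto intro!: sympI simp: ess_eq_def elim!: eventually_mono)
  show "transp ess_eq"
  proof (rule transpI)
    fix f g h assume "ess_eq f g" "ess_eq g h"
    moreover from this have "AE x in lborel. f x = g x" "AE x in lborel. g x = h x"
      by (auto simp: ess_eq_def)
    then have "AE x in lborel. f x = h x"
      by eventually_elim simp
    ultimately show "ess_eq f h"
      by (auto simp: ess_eq_def)
  qed
qed

instantiation linfty :: "{real_vector, order, one}"
begin

lift_definition zero_linfty :: linfty is "\<lambda>_. 0"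
  by (simp add: ess_eq_def ess_bounded_const)

lift_definition one_linfty :: linfty is "\<lambda>_. 1"
  by (simp add: ess_eq_def ess_bounded_const)

lift_definition plus_linfty :: "linfty \<Rightarrow> linfty \<Rightarrow> linfty" is "\<lambda>f g x. f x + g x"
  unfolding ess_eq_def by (auto intro: ess_bounded_add)

lift_definition minus_linfty :: "linfty \<Rightarrow> linfty \<Rightarrow> linfty" is "\<lambda>f g x. f x - g x"
  unfolding ess_eq_def by (auto intro: ess_bounded_diff)

lift_definition uminus_linfty :: "linfty \<Rightarrow> linfty" is "\<lambda>f x. - f x"
  unfolding ess_eq_def by (auto intro: ess_bounded_uminus)

lift_definition scaleR_linfty :: "real \<Rightarrow> linfty \<Rightarrow> linfty" is "\<lambda>c f x. c * f x"
  unfolding ess_eq_def by (auto intro: ess_bounded_scale)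

lift_definition less_eq_linfty :: "linfty \<Rightarrow> linfty \<Rightarrow> bool"
  is "\<lambda>f g. AE x in lborel. f x \<le> g x"
proof -
  fix f f' g g' assume "ess_eq f f'" "ess_eq g g'"
  then have "AE x in lborel. f x = f' x" "AE x in lborel. g x = g' x"
    by (auto simp: ess_eq_def)
  then have "AE x in lborel. (f x \<le> g x) = (f' x \<le> g' x)"
    by eventually_elim simp
  then show "(AE x in lborel. f x \<le> g x) = (AE x in lborel. f' x \<le> g' x)"
    by (rule eventually_subst)
qed

definition less_linfty :: "linfty \<Rightarrow> linfty \<Rightarrow> bool" where
  "less_linfty f g \<longleftrightarrow> f \<le> g \<and> \<not> g \<le> f"

instance
proof
  fix f g h :: linfty and a b :: real
  show "f + g + h = f + (g + h)"
    by transfer (auto simp: ess_eq_def algebra_simps intro: ess_bounded_add)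
  show "f + g = g + f"
    by transfer (auto simp: ess_eq_def algebra_simps intro: ess_bounded_add)
  show "0 + f = f"
    by transfer (auto simp: ess_eq_def)
  show "- f + f = 0"
    by transfer (auto simp: ess_eq_def intro: ess_bounded_const)
  show "f - g = f + - g"
    by transfer (auto simp: ess_eq_def intro: ess_bounded_diff)
  show "a *\<^sub>R (f + g) = a *\<^sub>R f + a *\<^sub>R g"
    by transfer (auto simp: ess_eq_def distrib_left
        intro: ess_bounded_scale ess_bounded_add)
  show "(a + b) *\<^sub>R f = a *\<^sub>R f + b *\<^sub>R f"
    by transfer (auto simp: ess_eq_def distrib_right
        intro: ess_bounded_scale ess_bounded_add)
  show "a *\<^sub>R b *\<^sub>R f = (a * b) *\<^sub>R f"
    by transfer (auto simp: ess_eq_def mult.assoc intro: ess_bounded_scale)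
  show "1 *\<^sub>R f = f"
    by transfer (auto simp: ess_eq_def)
  show "(f < g) = (f \<le> g \<and> \<not> g \<le> f)"
    by (rule less_linfty_def)
  show "f \<le> f"
    by transfer auto
  show "f \<le> g \<Longrightarrow> g \<le> h \<Longrightarrow> f \<le> h"
  proof transfer
    fix f g h :: "real \<Rightarrow> real"
    assume "AE x in lborel. f x \<le> g x" "AE x in lborel. g x \<le> h x"
    then show "AE x in lborel. f x \<le> h x" by eventually_elim simp
  qed
  show "f \<le> g \<Longrightarrow> g \<le> f \<Longrightarrow> f = g"
  proof transfer
    fix f g :: "real \<Rightarrow> real"
    assume fg: "ess_eq f f" "ess_eq g g"
    assume "AE x in lborel. f x \<le> g x" "AE x in lborel. g x \<le> f x"
    then have "AE x in lborel. f x = g x" by eventually_elim simp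
    with fg show "ess_eq f g" by (auto simp: ess_eq_def)
  qed
qed

end

instantiation linfty :: real_normed_vector
begin

lift_definition norm_linfty :: "linfty \<Rightarrow> real" is ess_norm
proof -
  fix f g assume fg: "ess_eq f g"
  then have mono: "f \<in> borel_measurable borel" "g \<in> borel_measurable borel"
    by (auto simp: ess_eq_def ess_bounded_def)
  have "AE x in lborel. ereal \<bar>f x\<bar> = ereal \<bar>g x\<bar>"
    using fg by (auto simp: ess_eq_def elim!: eventually_mono)
  then have "esssup lborel (\<lambda>x. ereal \<bar>f x\<bar>) = esssup lborel (\<lambda>x. ereal \<bar>g x\<bar>)"
    using mono by (intro esssup_AE_cong) auto
  then show "ess_norm f = ess_norm g"
    by (simp add: ess_norm_def)
qed

definition dist_linfty :: "linfty \<Rightarrow> linfty \<Rightarrow> real" where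
  "dist_linfty f g = norm (f - g)"

definition sgn_linfty :: "linfty \<Rightarrow> linfty" where
  "sgn_linfty f = inverse (norm f) *\<^sub>R f"

definition uniformity_linfty :: "(linfty \<times> linfty) filter" where
  "uniformity_linfty = (INF e\<in>{0<..}. principal {(f, g). dist f g < e})"

definition open_linfty :: "linfty set \<Rightarrow> bool" where
  "open_linfty U \<longleftrightarrow> (\<forall>f\<in>U. eventually (\<lambda>(f', g). f' = f \<longrightarrow> g \<in> U) uniformity)"

instance
proof
  fix f g :: linfty and a :: real and U :: "linfty set"
  show "dist f g = norm (f - g)" by (rule dist_linfty_def)
  show "sgn f = inverse (norm f) *\<^sub>R f" by (rule sgn_linfty_def)
  show "(uniformity :: (linfty \<times> linfty) filter)
      = (INF e\<in>{0<..}. principal {(f, g). dist f g < e})"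
    by (rule uniformity_linfty_def)
  show "open U = (\<forall>f\<in>U. \<forall>\<^sub>F (f', g) in uniformity. f' = f \<longrightarrow> g \<in> U)"
    by (rule open_linfty_def)
  show "(norm f = 0) = (f = 0)"
  proof transfer
    fix f assume "ess_eq f f"
    then have f: "f \<in> ess_bounded" by (simp add: ess_eq_def)
    show "(ess_norm f = 0) = ess_eq f (\<lambda>_. 0)"
    proof
      assume "ess_norm f = 0"
      with ess_norm_AE[OF f] have "AE x in lborel. f x = 0" by simp
      with f show "ess_eq f (\<lambda>_. 0)" by (simp add: ess_eq_def ess_bounded_const)
    next
      assume "ess_eq f (\<lambda>_. 0)"
      then have "AE x in lborel. \<bar>f x\<bar> \<le> 0" by (simp add: ess_eq_def)
      from ess_norm_least[OF f this] ess_norm_nonneg[OF f] show "ess_norm f = 0" by simp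
    qed
  qed
  show "norm (f + g) \<le> norm f + norm g"
  proof transfer
    fix f g assume "ess_eq f f" "ess_eq g g"
    then have f: "f \<in> ess_bounded" and g: "g \<in> ess_bounded" by (auto simp: ess_eq_def)
    have "AE x in lborel. \<bar>f x + g x\<bar> \<le> ess_norm f + ess_norm g"
      using ess_norm_AE[OF f] ess_norm_AE[OF g] by eventually_elim linarith
    then show "ess_norm (\<lambda>x. f x + g x) \<le> ess_norm f + ess_norm g"
      by (rule ess_norm_least[OF ess_bounded_add[OF f g]])
  qed
  show "norm (a *\<^sub>R f) = \<bar>a\<bar> * norm f"
  proof transfer
    fix a f assume "ess_eq f f"
    then have f: "f \<in> ess_bounded" by (simp add: ess_eq_def)
    have le: "ess_norm (\<lambda>x. c * h x) \<le> \<bar>c\<bar> * ess_norm h" if h: "h \<in> ess_bounded" for c h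
    proof (rule ess_norm_least[OF ess_bounded_scale[OF h]])
      show "AE x in lborel. \<bar>c * h x\<bar> \<le> \<bar>c\<bar> * ess_norm h"
        using ess_norm_AE[OF h] by eventually_elim (simp add: abs_mult mult_left_mono)
    qed
    show "ess_norm (\<lambda>x. a * f x) = \<bar>a\<bar> * ess_norm f"
    proof (cases "a = 0")
      case True
      then show ?thesis
        using le[OF f, of a] ess_norm_nonneg[OF ess_bounded_scale[OF f, of a]] by simp
    next
      case False
      then have "ess_norm f \<le> \<bar>inverse a\<bar> * ess_norm (\<lambda>x. a * f x)"
        using le[OF ess_bounded_scale[OF f, of a], of "inverse a"]
        by (simp add: mult.assoc[symmetric])
      with False have "\<bar>a\<bar> * ess_norm f \<le> ess_norm (\<lambda>x. a * f x)"
        by (simp add: abs_inverse field_simps)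
      with le[OF f, of a] show ?thesis by linarith
    qed
  qed
qed

end


section \<open>Two-parameter Markov semigroups\<close>

text \<open>The constant function 1 is the \<^term>\<open>1\<close> of \<^typ>\<open>linfty\<close>.\<close>

definition two_parameter_markov_semigroup_on ::
    "real set \<Rightarrow> (real \<Rightarrow> real \<Rightarrow> linfty \<Rightarrow> linfty) \<Rightarrow> bool" where
  "two_parameter_markov_semigroup_on I T \<longleftrightarrow>
     (\<forall>s\<in>I. \<forall>t\<in>I. s \<le> t \<longrightarrow> bounded_linear (T s t)) \<and>
     (\<forall>s\<in>I. T s s = id) \<and>
     (\<forall>s\<in>I. \<forall>t\<in>I. s \<le> t \<longrightarrow> T s t 1 = 1) \<and>
     (\<forall>s\<in>I. \<forall>t\<in>I. s \<le> t \<longrightarrow> (\<forall>F. 0 \<le> F \<longrightarrow> 0 \<le> T s t F)) \<and>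
     (\<forall>s\<in>I. \<forall>u\<in>I. \<forall>t\<in>I. s \<le> u \<and> u \<le> t \<longrightarrow> T s t = T s u \<circ> T u t)"


section \<open>W-Brownian bridges and W-Brownian motions\<close>

definition W_function :: "(real \<Rightarrow> real) \<Rightarrow> bool" where
  "W_function W \<longleftrightarrow>
     strict_mono W \<and>
     (\<forall>x. continuous (at_right x) W) \<and>
     (\<forall>x. \<exists>l. (W \<longlongrightarrow> l) (at_left x)) \<and>
     (\<forall>x. W (x + 1) - W x = W 1 - W 0) \<and>
     isCont W 0 \<and>
     W 0 = 0"

text \<open>
  The normal law with mean \<open>m\<close> and variance \<open>v\<close>; variance 0 gives a point mass, which cannot be
  avoided here, since a bridge is degenerate at the times 0 and 1.
\<close>

definition normal_law :: "real \<Rightarrow> real \<Rightarrow> real measure" where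
  "normal_law m v =
     (if v = 0 then return borel m
      else density lborel (\<lambda>x. ennreal (normal_density m (sqrt v) x)))"

definition gaussian_process :: "'a measure \<Rightarrow> 'i set \<Rightarrow> ('i \<Rightarrow> 'a \<Rightarrow> real) \<Rightarrow> bool" where
  "gaussian_process M I X \<longleftrightarrow>
     (\<forall>t\<in>I. X t \<in> borel_measurable M) \<and>
     (\<forall>J c. finite J \<and> J \<subseteq> I \<longrightarrow>
        (\<exists>m v. 0 \<le> v \<and> distr M borel (\<lambda>\<omega>. \<Sum>t\<in>J. c t * X t \<omega>) = normal_law m v))"

definition covariance :: "'a measure \<Rightarrow> ('a \<Rightarrow> real) \<Rightarrow> ('a \<Rightarrow> real) \<Rightarrow> real" where
  "covariance M X Y =
     (\<integral>\<omega>. (X \<omega> - (\<integral>\<omega>'. X \<omega>' \<partial>M)) * (Y \<omega> - (\<integral>\<omega>'. Y \<omega>' \<partial>M)) \<partial>M)"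

definition W_brownian_bridge ::
    "'a measure \<Rightarrow> (real \<Rightarrow> real) \<Rightarrow> (real \<Rightarrow> 'a \<Rightarrow> real) \<Rightarrow> bool" where
  "W_brownian_bridge M W B \<longleftrightarrow>
     gaussian_process M {0..1} B \<and>
     (\<forall>t\<in>{0..1}. (\<integral>\<omega>. B t \<omega> \<partial>M) = 0) \<and>
     (\<forall>t\<in>{0..1}. \<forall>s\<in>{0..1}. covariance M (B t) (B s) = W (min t s) - W t * W s / W 1)"

definition W_brownian_motion ::
    "'a measure \<Rightarrow> (real \<Rightarrow> real) \<Rightarrow> (real \<Rightarrow> 'a \<Rightarrow> real) \<Rightarrow> bool" where
  "W_brownian_motion M W B \<longleftrightarrow>
     (\<exists>B0 B1.
        W_brownian_bridge M W B0 \<and>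
        B1 \<in> borel_measurable M \<and>
        distr M borel B1 = normal_law 0 (W 1) \<and>
        prob_space.indep_set M
          (sigma_sets (space M) {B1 -` A \<inter> space M | A. A \<in> sets borel})
          (sigma_sets (space M) {B0 t -` A \<inter> space M | t A. t \<in> {0..1} \<and> A \<in> sets borel}) \<and>
        (\<forall>t\<in>{0..1}. \<forall>\<omega>\<in>space M. B t \<omega> = B0 t \<omega> + W t / W 1 * B1 \<omega>))"

text \<open>
  The operator is evaluated on the representative chosen by \<^const>\<open>rep_linfty\<close>; the
  definition alone does not say that the result is the same for every representative.
\<close>

definition increment_operator ::
    "'a measure \<Rightarrow> (real \<Rightarrow> 'a \<Rightarrow> real) \<Rightarrow> real \<Rightarrow> real \<Rightarrow> linfty \<Rightarrow> linfty" where
  "increment_operator M B s t F =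
     Linfty (\<lambda>x. \<integral>\<omega>. rep_linfty F (x + B t \<omega> - B s \<omega>) \<partial>M)"

end

theory Submission
  imports Defs
begin

text \<open>
  The operator belonging to \<open>s \<le> t\<close> depends on the process only through the law of the increment
  \<open>B t - B s\<close>: it averages the translates of \<open>f\<close> with respect to that law.  The increment of the
  bridge is normal with variance \<open>d - d\<^sup>2 / W 1\<close>, where \<open>d = W t - W s\<close>, and the independent term
  \<open>(d / W 1) * B1\<close> contributes the missing \<open>d\<^sup>2 / W 1\<close>.  So the law is normal with mean 0 and
  variance \<open>d\<close> (\<open>W_brownian_motion_increment\<close>).

  Averaging translates against any Borel probability measure \<open>\<mu>\<close> is a positive contraction of
  \<open>L\<^sup>\<infinity>\<close> that fixes the constants.  It is well defined on classes because, by Fubini, a Lebesgue null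
  set is hit by \<open>x + y\<close>, with \<open>y\<close> distributed according to \<open>\<mu>\<close>, with probability 0 for almost every
  \<open>x\<close> (\<open>AE_translate\<close>), even when \<open>\<mu>\<close> has point masses.  The composition of
  two such operators belongs to the convolution of the measures
  (\<open>convolution_operator_convolution\<close>).

  The semigroup law \<open>T s t = T s u \<circ> T u t\<close> is therefore the convolution identity for centered normal
  laws, whose variances \<open>W u - W s\<close> and \<open>W t - W u\<close> add up to \<open>W t - W s\<close>
  (\<open>normal_law_convolution\<close>).  Strict monotonicity of \<open>W\<close> makes the law of the increment
  absolutely continuous when \<open>s < t\<close>, which upgrades integrability of \<open>f (x + B t - B s)\<close> from
  almost every \<open>x\<close> to every \<open>x\<close>;
  when \<open>s = t\<close> this variable is constant.
\<close>

section \<open>Classes of essentially bounded functions\<close>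

lemma Linfty_eq_iff: "f \<in> ess_bounded \<Longrightarrow> g \<in> ess_bounded \<Longrightarrow>
    Linfty f = Linfty g \<longleftrightarrow> (AE x in lborel. f x = g x)"
  using Quotient3_rel[OF Quotient3_linfty, of f g] by (auto simp: ess_eq_def)

lemma rep_linfty_ess_bounded: "rep_linfty F \<in> ess_bounded"
  using Quotient3_rep_reflp[OF Quotient3_linfty, of F] by (simp add: ess_eq_def)

lemma Linfty_rep_linfty: "Linfty (rep_linfty F) = F"
  by (rule Quotient3_abs_rep[OF Quotient3_linfty])

lemma rep_linfty_Linfty:
  assumes "f \<in> ess_bounded"
  shows "AE x in lborel. rep_linfty (Linfty f) x = f x"
  using assms by (simp flip: Linfty_eq_iff add: rep_linfty_ess_bounded Linfty_rep_linfty)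

lemma Linfty_cases:
  obtains f where "f \<in> ess_bounded" "F = Linfty f"
  using Linfty_rep_linfty[of F] rep_linfty_ess_bounded[of F] by metis

lemma Linfty_add:
  assumes "f \<in> ess_bounded" "g \<in> ess_bounded"
  shows "Linfty f + Linfty g = Linfty (\<lambda>x. f x + g x)"
  by (rule plus_linfty.abs_eq) (use assms in \<open>auto simp: ess_eq_def\<close>)

lemma Linfty_scaleR: "f \<in> ess_bounded \<Longrightarrow> c *\<^sub>R Linfty f = Linfty (\<lambda>x. c * f x)"
  by (rule scaleR_linfty.abs_eq) (auto simp: ess_eq_def)

lemma Linfty_nonneg_iff: "f \<in> ess_bounded \<Longrightarrow> 0 \<le> Linfty f \<longleftrightarrow> (AE x in lborel. 0 \<le> f x)"
  unfolding zero_linfty_def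
  by (subst less_eq_linfty.abs_eq) (auto simp: ess_eq_def ess_bounded_const)

lemma norm_Linfty: "f \<in> ess_bounded \<Longrightarrow> norm (Linfty f) = ess_norm f"
  by (rule norm_linfty.abs_eq) (auto simp: ess_eq_def)


section \<open>Averages of translates\<close>

definition translate_average :: "real measure \<Rightarrow> (real \<Rightarrow> real) \<Rightarrow> real \<Rightarrow> real" where
  "translate_average \<mu> f x = (\<integral>y. f (x + y) \<partial>\<mu>)"

locale borel_prob_space = prob_space \<mu> for \<mu> :: "real measure" +
  assumes sets_eq_borel [measurable_cong]: "sets \<mu> = sets borel"
begin

text \<open>
  Lebesgue measure is translation invariant, so a null set has null translates, and by Fubini
  almost every point \<open>x\<close> is moved into it only with probability 0.
\<close>

lemma AE_translate:
  assumes "AE x in lborel. P x"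
  shows "AE x in lborel. AE y in \<mu>. P (x + y)"
proof -
  interpret pair_sigma_finite lborel \<mu> ..
  obtain N where N: "{x \<in> space lborel. \<not> P x} \<subseteq> N" "N \<in> null_sets lborel"
    using assms by (auto simp: eventually_ae_filter)
  then have [measurable]: "N \<in> sets borel" by auto
  have "AE x in lborel. x + y \<notin> N" for y
  proof -
    have "AE x in distr lborel borel ((+) y). x \<notin> N"
      unfolding lborel_distr_plus using N(2) by (rule AE_not_in)
    then show ?thesis
      by (subst (asm) AE_distr_iff) (auto simp: add.commute)
  qed
  then have "AE y in \<mu>. AE x in lborel. x + y \<notin> N" by simp
  moreover have "{p \<in> space (lborel \<Otimes>\<^sub>M \<mu>). fst p + snd p \<notin> N} \<in> sets (lborel \<Otimes>\<^sub>M \<mu>)"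
    by measurable
  ultimately have "AE x in lborel. AE y in \<mu>. x + y \<notin> N"
    by (subst AE_commute)
  then show ?thesis
    by (rule eventually_mono) (use N(1) in \<open>auto elim!: eventually_mono\<close>)
qed

text \<open>
  A bound for \<open>f\<close> may fail on a null set, and an atom of \<open>\<mu>\<close> can move a particular \<open>x\<close> into that
  set; so an exceptional null set of \<open>x\<close> remains.
\<close>

lemma AE_integrable_translate:
  assumes f: "f \<in> ess_bounded"
  shows "AE x in lborel. integrable \<mu> (\<lambda>y. f (x + y))"
proof -
  note [measurable] = ess_bounded_measurable[OF f]
  obtain C where "AE x in lborel. \<bar>f x\<bar> \<le> C" using f by (rule ess_boundedE)
  from AE_translate[OF this] show ?thesis
    by eventually_elim (rule integrable_const_bound[where B = C], auto)
qed

lemma translate_average_measurable [measurable]: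
  assumes [measurable]: "f \<in> borel_measurable borel"
  shows "translate_average \<mu> f \<in> borel_measurable borel"
  unfolding translate_average_def[abs_def] by measurable

lemma AE_abs_translate_average_le:
  assumes f: "f \<in> ess_bounded" and C: "AE x in lborel. \<bar>f x\<bar> \<le> C"
  shows "AE x in lborel. \<bar>translate_average \<mu> f x\<bar> \<le> C"
  using AE_translate[OF C] AE_integrable_translate[OF f]
proof eventually_elim
  case (elim x)
  have "\<bar>translate_average \<mu> f x\<bar> \<le> (\<integral>y. \<bar>f (x + y)\<bar> \<partial>\<mu>)"
    unfolding translate_average_def by (rule integral_abs_bound)
  also have "\<dots> \<le> (\<integral>y. C \<partial>\<mu>)"
    using elim by (intro integral_mono_AE) auto
  finally show ?case by (simp add: prob_space)
qed

lemma translate_average_ess_bounded: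
  assumes "f \<in> ess_bounded"
  shows "translate_average \<mu> f \<in> ess_bounded"
proof -
  obtain C where "AE x in lborel. \<bar>f x\<bar> \<le> C" using assms by (rule ess_boundedE)
  from AE_abs_translate_average_le[OF assms this] show ?thesis
    by (rule ess_boundedI[rotated]) (use assms in measurable)
qed

lemma AE_translate_average_cong:
  assumes "AE x in lborel. f x = g x" "f \<in> ess_bounded" "g \<in> ess_bounded"
  shows "AE x in lborel. translate_average \<mu> f x = translate_average \<mu> g x"
proof -
  note [measurable] = assms(2,3)[THEN ess_bounded_measurable]
  show ?thesis
    using AE_translate[OF assms(1)] unfolding translate_average_def
    by eventually_elim (rule integral_cong_AE, auto)
qed

end

lemma borel_prob_space_convolution:
  assumes "borel_prob_space \<mu>" "borel_prob_space \<nu>"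
  shows "borel_prob_space (\<mu> \<star> \<nu>)"
proof -
  interpret m: borel_prob_space \<mu> by fact
  interpret n: borel_prob_space \<nu> by fact
  interpret pair_prob_space \<mu> \<nu> ..
  have "prob_space (\<mu> \<star> \<nu>)"
    unfolding convolution_def by (rule prob_space_distr) measurable
  then show ?thesis
    by (auto simp: borel_prob_space_def borel_prob_space_axioms_def)
qed

text \<open>
  This is Fubini's theorem for \<open>(y, z) \<mapsto> f (x + (y + z))\<close>.  It applies wherever this function is
  integrable for the product measure, which means integrability of \<open>f (x + w)\<close> under the convolution,
  and that holds for almost every \<open>x\<close>.
\<close>

lemma AE_translate_average_convolution:
  assumes mu: "borel_prob_space \<mu>" and nu: "borel_prob_space \<nu>" and f: "f \<in> ess_bounded"
  shows "AE x in lborel.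
    translate_average (\<mu> \<star> \<nu>) f x = translate_average \<mu> (translate_average \<nu> f) x"
proof -
  interpret m: borel_prob_space \<mu> by fact
  interpret n: borel_prob_space \<nu> by fact
  interpret c: borel_prob_space "\<mu> \<star> \<nu>" by (rule borel_prob_space_convolution[OF mu nu])
  interpret pair_prob_space \<mu> \<nu> ..
  note [measurable] = ess_bounded_measurable[OF f]
  show ?thesis
    using c.AE_integrable_translate[OF f]
  proof eventually_elim
    case (elim x)
    then have int: "integrable (\<mu> \<Otimes>\<^sub>M \<nu>) (\<lambda>(y, z). f (x + (y + z)))"
      unfolding convolution_def by (subst (asm) integrable_distr_eq) (auto simp: split_beta')
    have "translate_average (\<mu> \<star> \<nu>) f x = (\<integral>(y, z). f (x + (y + z)) \<partial>(\<mu> \<Otimes>\<^sub>M \<nu>))"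
      unfolding translate_average_def convolution_def
      by (subst integral_distr) (auto simp: split_beta')
    also have "\<dots> = (\<integral>y. (\<integral>z. f (x + (y + z)) \<partial>\<nu>) \<partial>\<mu>)"
      using integral_fst'[OF int] by simp
    also have "\<dots> = translate_average \<mu> (translate_average \<nu> f) x"
      by (simp add: translate_average_def add.assoc)
    finally show ?case .
  qed
qed

text \<open>
  Evaluation on the representative chosen by \<^const>\<open>rep_linfty\<close> follows the pattern of
  \<^const>\<open>increment_operator\<close>; \<open>convolution_operator_Linfty\<close> shows that any other representative
  gives the same class.
\<close>

definition convolution_operator :: "real measure \<Rightarrow> linfty \<Rightarrow> linfty" where
  "convolution_operator \<mu> F = Linfty (translate_average \<mu> (rep_linfty F))"

context borel_prob_space
begin

lemma convolution_operator_Linfty: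
  assumes "f \<in> ess_bounded"
  shows "convolution_operator \<mu> (Linfty f) = Linfty (translate_average \<mu> f)"
  unfolding convolution_operator_def
  using AE_translate_average_cong[OF rep_linfty_Linfty[OF assms] rep_linfty_ess_bounded assms]
  by (simp add: Linfty_eq_iff translate_average_ess_bounded rep_linfty_ess_bounded assms)

lemma bounded_linear_convolution_operator: "bounded_linear (convolution_operator \<mu>)"
proof (rule bounded_linear_intro[where K = 1])
  fix F G :: linfty and c :: real
  obtain f where f: "f \<in> ess_bounded" "F = Linfty f" by (rule Linfty_cases)
  obtain g where g: "g \<in> ess_bounded" "G = Linfty g" by (rule Linfty_cases)
  note bounded = f(1) g(1) ess_bounded_add[OF f(1) g(1)] ess_bounded_scale[OF f(1)]
    translate_average_ess_bounded ess_bounded_add ess_bounded_scale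
  have "AE x in lborel. translate_average \<mu> (\<lambda>x. f x + g x) x
      = translate_average \<mu> f x + translate_average \<mu> g x"
    using AE_integrable_translate[OF f(1)] AE_integrable_translate[OF g(1)]
    by eventually_elim (simp add: translate_average_def)
  then show "convolution_operator \<mu> (F + G) = convolution_operator \<mu> F + convolution_operator \<mu> G"
    by (simp add: f(2) g(2) Linfty_add convolution_operator_Linfty Linfty_eq_iff bounded)
  have scale: "translate_average \<mu> (\<lambda>x. c * f x) = (\<lambda>x. c * translate_average \<mu> f x)"
    by (simp add: translate_average_def fun_eq_iff)
  show "convolution_operator \<mu> (c *\<^sub>R F) = c *\<^sub>R convolution_operator \<mu> F"
    by (simp add: f(2) Linfty_scaleR convolution_operator_Linfty bounded scale)
  have "ess_norm (translate_average \<mu> f) \<le> ess_norm f"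
    using AE_abs_translate_average_le[OF f(1) ess_norm_AE[OF f(1)]]
    by (intro ess_norm_least) (auto intro: bounded)
  then show "norm (convolution_operator \<mu> F) \<le> norm F * 1"
    by (simp add: f(2) norm_Linfty convolution_operator_Linfty bounded)
qed

lemma convolution_operator_one: "convolution_operator \<mu> 1 = 1"
  unfolding one_linfty_def
  by (simp add: convolution_operator_Linfty ess_bounded_const translate_average_def[abs_def] prob_space)

lemma convolution_operator_nonneg:
  assumes "0 \<le> F"
  shows "0 \<le> convolution_operator \<mu> F"
proof -
  obtain f where f: "f \<in> ess_bounded" "F = Linfty f" by (rule Linfty_cases)
  then have "AE x in lborel. 0 \<le> f x" using assms by (simp add: Linfty_nonneg_iff)
  from AE_translate[OF this] have "AE x in lborel. 0 \<le> translate_average \<mu> f x"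
    unfolding translate_average_def by eventually_elim (rule integral_nonneg_AE)
  then show ?thesis
    using f by (simp add: convolution_operator_Linfty Linfty_nonneg_iff translate_average_ess_bounded)
qed

end

lemma convolution_operator_convolution:
  assumes "borel_prob_space \<mu>" "borel_prob_space \<nu>"
  shows "convolution_operator (\<mu> \<star> \<nu>) = convolution_operator \<mu> \<circ> convolution_operator \<nu>"
proof
  fix F
  interpret m: borel_prob_space \<mu> by fact
  interpret n: borel_prob_space \<nu> by fact
  interpret c: borel_prob_space "\<mu> \<star> \<nu>" by (rule borel_prob_space_convolution[OF assms])
  obtain f where f: "f \<in> ess_bounded" "F = Linfty f" by (rule Linfty_cases)
  show "convolution_operator (\<mu> \<star> \<nu>) F = (convolution_operator \<mu> \<circ> convolution_operator \<nu>) F"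
    using AE_translate_average_convolution[OF assms f(1)]
    by (simp add: f m.convolution_operator_Linfty n.convolution_operator_Linfty
        c.convolution_operator_Linfty Linfty_eq_iff n.translate_average_ess_bounded
        m.translate_average_ess_bounded c.translate_average_ess_bounded)
qed

lemma convolution_operator_return_0: "convolution_operator (return borel 0) = id"
proof
  fix F
  have "translate_average (return borel 0) (rep_linfty F) = rep_linfty F"
    using ess_bounded_measurable[OF rep_linfty_ess_bounded[of F]]
    by (auto simp: translate_average_def integral_return)
  then show "convolution_operator (return borel 0) F = id F"
    by (simp add: convolution_operator_def Linfty_rep_linfty)
qed


section \<open>Normal laws\<close>

text \<open>
  Writing normal laws as affine images of the standard one treats variance 0 together with positive
  variance, so that moments and scaling need no case distinction.
\<close>

lemma normal_law_eq_distr: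
  assumes "0 \<le> v"
  shows "normal_law m v = distr std_normal_distribution borel (\<lambda>x. m + sqrt v * x)"
proof (cases "v = 0")
  case True
  interpret prob_space std_normal_distribution by (rule prob_space_normal_density) simp
  from True show ?thesis by (simp add: normal_law_def)
next
  case False
  interpret prob_space std_normal_distribution by (rule prob_space_normal_density) simp
  have "distributed std_normal_distribution lborel (\<lambda>x. x) std_normal_density"
    by (auto simp: distributed_def intro!: measure_eqI simp: emeasure_distr)
  then have "distributed std_normal_distribution lborel (\<lambda>x. m + sqrt v * x)
      (normal_density (m + sqrt v * 0) (\<bar>sqrt v\<bar> * 1))"
    by (rule normal_density_affine) (use False in auto)
  then have "distr std_normal_distribution lborel (\<lambda>x. m + sqrt v * x)
      = density lborel (normal_density m (sqrt v))"
    using assms by (simp add: distributed_def)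
  moreover have "distr std_normal_distribution lborel (\<lambda>x. m + sqrt v * x)
      = distr std_normal_distribution borel (\<lambda>x. m + sqrt v * x)"
    by (rule distr_cong) auto
  ultimately show ?thesis using False by (simp add: normal_law_def)
qed

lemma borel_prob_space_normal_law:
  assumes "0 \<le> v"
  shows "borel_prob_space (normal_law m v)"
proof -
  interpret prob_space std_normal_distribution by (rule prob_space_normal_density) simp
  show ?thesis
    unfolding normal_law_eq_distr[OF assms]
    by (auto simp: borel_prob_space_def borel_prob_space_axioms_def intro: prob_space_distr)
qed

lemma (in prob_space) normal_law_moments:
  assumes [measurable]: "X \<in> borel_measurable M"
    and v: "0 \<le> v" and law: "distr M borel X = normal_law m v"
  shows "integrable M X" "integrable M (\<lambda>\<omega>. (X \<omega>)\<^sup>2)"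
    "expectation X = m" "expectation (\<lambda>\<omega>. (X \<omega>)\<^sup>2) = m\<^sup>2 + v"
proof -
  define S where "S = std_normal_distribution"
  interpret S: prob_space S unfolding S_def by (rule prob_space_normal_density) simp
  have [measurable_cong]: "sets S = sets borel" by (simp add: S_def)
  have law': "distr M borel X = distr S borel (\<lambda>x. m + sqrt v * x)"
    using law normal_law_eq_distr[OF v] by (simp add: S_def)
  have int: "integrable S (\<lambda>x. g (m + sqrt v * x)) \<Longrightarrow> integrable M (\<lambda>\<omega>. g (X \<omega>))"
    and eq: "expectation (\<lambda>\<omega>. g (X \<omega>)) = (\<integral>x. g (m + sqrt v * x) \<partial>S)"
    if [measurable]: "g \<in> borel_measurable borel" for g :: "real \<Rightarrow> real"
    using arg_cong[OF law', of "\<lambda>L. integrable L g"] arg_cong[OF law', of "\<lambda>L. integral\<^sup>L L g"]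
    by (simp_all add: integrable_distr_eq integral_distr)
  have int1: "integrable S (\<lambda>x. x)" and int2: "integrable S (\<lambda>x. x\<^sup>2)"
    unfolding S_def using integrable_std_normal_distribution_moment[of 1]
      integrable_std_normal_distribution_moment[of 2] by simp_all
  have E1: "(\<integral>x. x \<partial>S) = 0" and E2: "(\<integral>x. x\<^sup>2 \<partial>S) = 1"
    unfolding S_def using integral_std_normal_distribution_moment_odd[of 1]
      std_normal_distribution_even_moments(1)[of 1] by simp_all
  have square: "(m + sqrt v * x)\<^sup>2 = m\<^sup>2 + 2 * m * sqrt v * x + v * x\<^sup>2" for x
    using v by (simp add: power2_sum power_mult_distrib algebra_simps)
  have affine: "integrable S (\<lambda>x. m + sqrt v * x)"
    by (intro Bochner_Integration.integrable_add integrable_mult_right S.integrable_const int1)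
  have square_int: "integrable S (\<lambda>x. m\<^sup>2 + 2 * m * sqrt v * x + v * x\<^sup>2)"
    by (intro Bochner_Integration.integrable_add integrable_mult_right S.integrable_const int1 int2)
  show "integrable M X"
    by (rule int[of "\<lambda>x. x"]) (measurable, rule affine)
  show "integrable M (\<lambda>\<omega>. (X \<omega>)\<^sup>2)"
    by (rule int) (measurable, unfold square, rule square_int)
  have "(\<integral>x. m + sqrt v * x \<partial>S) = (\<integral>x. m \<partial>S) + sqrt v * (\<integral>x. x \<partial>S)"
    by (subst Bochner_Integration.integral_add,
        intro S.integrable_const,
        intro integrable_mult_right int1)
      (simp only: integral_mult_right_zero)
  then show "expectation X = m"
    using eq[of "\<lambda>x. x"] by (simp add: E1 S.prob_space)
  have "(\<integral>x. m\<^sup>2 + 2 * m * sqrt v * x + v * x\<^sup>2 \<partial>S)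
      = (\<integral>x. m\<^sup>2 \<partial>S) + 2 * m * sqrt v * (\<integral>x. x \<partial>S) + v * (\<integral>x. x\<^sup>2 \<partial>S)"
    by (subst Bochner_Integration.integral_add,
        intro Bochner_Integration.integrable_add integrable_mult_right S.integrable_const int1,
        intro integrable_mult_right int2,
        subst Bochner_Integration.integral_add,
        intro S.integrable_const,
        intro integrable_mult_right int1)
      (simp only: integral_mult_right_zero)
  then show "expectation (\<lambda>\<omega>. (X \<omega>)\<^sup>2) = m\<^sup>2 + v"
    using eq[of "\<lambda>x. x\<^sup>2"] by (simp add: square E1 E2 S.prob_space)
qed

lemma (in prob_space) distr_scale_normal_law:
  assumes [measurable]: "X \<in> borel_measurable M"
    and "0 \<le> v" "0 \<le> c" and law: "distr M borel X = normal_law 0 v"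
  shows "distr M borel (\<lambda>\<omega>. c * X \<omega>) = normal_law 0 (c\<^sup>2 * v)"
proof -
  have "distr M borel (\<lambda>\<omega>. c * X \<omega>) = distr (distr M borel X) borel ((*) c)"
    by (simp add: distr_distr o_def)
  also have "\<dots> = distr std_normal_distribution borel (\<lambda>x. c * (sqrt v * x))"
    unfolding law using assms by (simp add: normal_law_eq_distr distr_distr o_def)
  also have "\<dots> = normal_law 0 (c\<^sup>2 * v)"
    using assms by (simp add: normal_law_eq_distr real_sqrt_mult mult.assoc)
  finally show ?thesis .
qed

lemma convolution_return_0:
  assumes "borel_prob_space \<mu>"
  shows "(\<mu> \<star> return borel 0) = \<mu>"
proof (rule measure_eqI)
  interpret borel_prob_space \<mu> by fact
  show "sets (\<mu> \<star> return borel 0) = sets \<mu>" by (simp add: sets_eq_borel)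
  fix A assume "A \<in> sets (\<mu> \<star> return borel 0)"
  then have [measurable]: "A \<in> sets borel" by simp
  have "finite_measure (return borel (0 :: real))"
    by (intro prob_space.finite_measure prob_space_return) simp
  then have "emeasure (\<mu> \<star> return borel 0) A
      = (\<integral>\<^sup>+x. \<integral>\<^sup>+y. indicator A (x + y) \<partial>return borel 0 \<partial>\<mu>)"
    by (intro convolution_emeasure') (auto simp: sets_eq_borel finite_measure_axioms)
  also have "\<dots> = (\<integral>\<^sup>+x. indicator A x \<partial>\<mu>)"
    by (intro nn_integral_cong) (simp add: nn_integral_return)
  finally show "emeasure (\<mu> \<star> return borel 0) A = emeasure \<mu> A" by simp
qed

text \<open>
  A law of variance 0 is the point mass at 0, which is neutral for convolution; for two positive
  variances the convolution has a density, the convolution integral of the two densities.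
\<close>

lemma normal_law_convolution:
  assumes "0 \<le> a" "0 \<le> b"
  shows "(normal_law 0 a \<star> normal_law 0 b) = normal_law 0 (a + b)"
proof -
  note prob = assms[THEN borel_prob_space_normal_law, of 0]
  interpret A: borel_prob_space "normal_law 0 a" by (rule prob)
  interpret B: borel_prob_space "normal_law 0 b" by (rule prob)
  consider "b = 0" | "a = 0" | "0 < a" "0 < b" using assms by linarith
  then show ?thesis
  proof cases
    case 1
    then show ?thesis using convolution_return_0[OF prob(1)] by (simp add: normal_law_def)
  next
    case 2
    have "(normal_law 0 a \<star> normal_law 0 b) = (normal_law 0 b \<star> normal_law 0 a)"
      by (intro convolution_commutative A.finite_measure_axioms B.finite_measure_axioms
          A.sets_eq_borel B.sets_eq_borel)
    with 2 show ?thesis using convolution_return_0[OF prob(2)] by (simp add: normal_law_def)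
  next
    case 3
    have "(density lborel (normal_density 0 (sqrt a)) \<star> density lborel (normal_density 0 (sqrt b)))
      = density lborel (\<lambda>x. \<integral>\<^sup>+y. ennreal (normal_density 0 (sqrt a) (x - y))
          * ennreal (normal_density 0 (sqrt b) y) \<partial>lborel)"
      using 3 by (intro convolution_density prob_space.finite_measure prob_space_normal_density) auto
    also have "\<dots> = density lborel (normal_density 0 (sqrt (a + b)))"
      using conv_normal_density_zero_mean[of "sqrt a" "sqrt b"] 3
      by (simp add: ennreal_mult fun_eq_iff)
    finally show ?thesis using 3 by (simp add: normal_law_def)
  qed
qed

text \<open>
  Absolute continuity: unlike in \<open>AE_translate\<close>, no point \<open>x\<close> is exceptional.
\<close>

lemma AE_normal_law_translate:
  assumes "0 < v" "AE x in lborel. P x"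
  shows "AE y in normal_law m v. P (x + y)"
proof -
  have "AE y in distr lborel borel ((+) x). P y"
    unfolding lborel_distr_plus by fact
  then have "AE y in lborel. P (x + y)"
    by (rule AE_distrD[rotated]) simp
  then show ?thesis
    using assms(1) unfolding normal_law_def by (auto simp: AE_density elim!: eventually_mono)
qed


section \<open>Increments of a W-Brownian motion\<close>

text \<open>
  An increment is a linear combination of two values of a Gaussian process, hence normal.  Its mean
  is 0, so its variance is its second moment, which expands into three covariances of the bridge.
\<close>

lemma W_brownian_bridge_increment:
  assumes "prob_space M" and bridge: "W_brownian_bridge M W B"
    and st: "0 \<le> s" "s < t" "t \<le> 1"
  shows "distr M borel (\<lambda>\<omega>. B t \<omega> - B s \<omega>)
      = normal_law 0 ((W t - W s) - (W t - W s)\<^sup>2 / W 1)"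
    and "0 \<le> (W t - W s) - (W t - W s)\<^sup>2 / W 1"
proof -
  interpret prob_space M by fact
  have rv [measurable]: "B r \<in> borel_measurable M" if "r \<in> {0..1}" for r
    using bridge that by (auto simp: W_brownian_bridge_def gaussian_process_def)
  have law: "\<exists>m v. 0 \<le> v \<and> distr M borel (\<lambda>\<omega>. \<Sum>r\<in>J. c r * B r \<omega>) = normal_law m v"
    if "finite J" "J \<subseteq> {0..1}" for J and c :: "real \<Rightarrow> real"
    using bridge that by (auto simp: W_brownian_bridge_def gaussian_process_def)
  have mean: "expectation (B r) = 0" if "r \<in> {0..1}" for r
    using bridge that by (auto simp: W_brownian_bridge_def)
  have cov: "expectation (\<lambda>\<omega>. B r \<omega> * B q \<omega>) = W (min r q) - W r * W q / W 1"
    if "r \<in> {0..1}" "q \<in> {0..1}" for r q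
    using bridge that by (auto simp: W_brownian_bridge_def covariance_def)
  have t: "t \<in> {0..1}" and s: "s \<in> {0..1}" using st by auto
  \<comment> \<open>The single values are normal too, hence square integrable, so the square of the increment can
    be expanded under the integral.\<close>
  have int: "integrable M (B r)" "integrable M (\<lambda>\<omega>. (B r \<omega>)\<^sup>2)" if r: "r \<in> {0..1}" for r
  proof -
    obtain m v where "0 \<le> v" "distr M borel (\<lambda>\<omega>. \<Sum>q\<in>{r}. 1 * B q \<omega>) = normal_law m v"
      using law[of "{r}" "\<lambda>_. 1"] r by auto
    then show "integrable M (B r)" "integrable M (\<lambda>\<omega>. (B r \<omega>)\<^sup>2)"
      using normal_law_moments(1,2)[OF rv[OF r], of v m] by simp_all
  qed
  have [measurable]: "B t \<in> borel_measurable M" "B s \<in> borel_measurable M"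
    using t s by (auto intro: rv)
  obtain m v where v: "0 \<le> v"
    and "distr M borel (\<lambda>\<omega>. \<Sum>q\<in>{s, t}. (if q = t then 1 else -1) * B q \<omega>) = normal_law m v"
    using law[of "{s, t}" "\<lambda>q. if q = t then 1 else -1"] s t by auto
  then have distr: "distr M borel (\<lambda>\<omega>. B t \<omega> - B s \<omega>) = normal_law m v"
    using st by simp
  have "expectation (\<lambda>\<omega>. B t \<omega> - B s \<omega>) = m"
    and var: "expectation (\<lambda>\<omega>. (B t \<omega> - B s \<omega>)\<^sup>2) = m\<^sup>2 + v"
    using normal_law_moments(3,4)[OF _ v distr] by simp_all
  then have m: "m = 0" using int mean s t by simp
  have prod: "integrable M (\<lambda>\<omega>. B t \<omega> * B s \<omega>)"
  proof (rule Bochner_Integration.integrable_bound)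
    show "integrable M (\<lambda>\<omega>. (B t \<omega>)\<^sup>2 + (B s \<omega>)\<^sup>2)" using int s t by simp
    have "\<bar>x * y\<bar> \<le> x\<^sup>2 + y\<^sup>2" for x y :: real
      using sum_squares_bound[of "\<bar>x\<bar>" "\<bar>y\<bar>"] mult_nonneg_nonneg[of "\<bar>x\<bar>" "\<bar>y\<bar>"]
      by (simp add: abs_mult del: mult_nonneg_nonneg)
    then show "AE \<omega> in M. norm (B t \<omega> * B s \<omega>) \<le> norm ((B t \<omega>)\<^sup>2 + (B s \<omega>)\<^sup>2)" by simp
  qed measurable
  have "expectation (\<lambda>\<omega>. (B t \<omega> - B s \<omega>)\<^sup>2)
      = expectation (\<lambda>\<omega>. (B t \<omega>)\<^sup>2 + (B s \<omega>)\<^sup>2 - 2 * (B t \<omega> * B s \<omega>))"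
    by (simp add: power2_diff algebra_simps)
  also have "\<dots> = expectation (\<lambda>\<omega>. B t \<omega> * B t \<omega>) + expectation (\<lambda>\<omega>. B s \<omega> * B s \<omega>)
      - 2 * expectation (\<lambda>\<omega>. B t \<omega> * B s \<omega>)"
    using int s t prod by (simp add: power2_eq_square)
  also have "\<dots> = (W t - W s) - (W t - W s)\<^sup>2 / W 1"
    unfolding cov[OF t t] cov[OF s s] cov[OF t s] using st
    by (simp add: power2_eq_square diff_divide_distrib add_divide_distrib algebra_simps)
  finally have "v = (W t - W s) - (W t - W s)\<^sup>2 / W 1" using var m by simp
  with v distr m show "distr M borel (\<lambda>\<omega>. B t \<omega> - B s \<omega>)
      = normal_law 0 ((W t - W s) - (W t - W s)\<^sup>2 / W 1)"
    and "0 \<le> (W t - W s) - (W t - W s)\<^sup>2 / W 1" by simp_all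
qed

text \<open>
  With \<open>d = W t - W s\<close>, the increment is that of the bridge, of variance \<open>d - d\<^sup>2 / W 1\<close>, plus the
  independent normal variable \<open>(d / W 1) * B1\<close>, of variance \<open>d\<^sup>2 / W 1\<close>.
\<close>

lemma W_brownian_motion_increment:
  assumes "prob_space M" and "W_function W" and motion: "W_brownian_motion M W B"
    and st: "0 \<le> s" "s \<le> t" "t \<le> 1"
  shows "distr M borel (\<lambda>\<omega>. B t \<omega> - B s \<omega>) = normal_law 0 (W t - W s)"
    and "(\<lambda>\<omega>. B t \<omega> - B s \<omega>) \<in> borel_measurable M"
proof -
  interpret prob_space M by fact
  have mono: "strict_mono W" and W0: "W 0 = 0" using \<open>W_function W\<close> by (auto simp: W_function_def)
  then have W1: "0 < W 1" using strict_monoD[of W 0 1] by simp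
  obtain B0 B1 where bridge: "W_brownian_bridge M W B0"
    and B1 [measurable]: "B1 \<in> borel_measurable M"
    and B1_law: "distr M borel B1 = normal_law 0 (W 1)"
    and indep: "indep_set
          (sigma_sets (space M) {B1 -` A \<inter> space M | A. A \<in> sets borel})
          (sigma_sets (space M) {B0 r -` A \<inter> space M | r A. r \<in> {0..1} \<and> A \<in> sets borel})"
    and B: "\<And>r \<omega>. r \<in> {0..1} \<Longrightarrow> \<omega> \<in> space M \<Longrightarrow> B r \<omega> = B0 r \<omega> + W r / W 1 * B1 \<omega>"
    using motion by (auto simp: W_brownian_motion_def)
  have B0 [measurable]: "B0 r \<in> borel_measurable M" if "r \<in> {0..1}" for r
    using bridge that by (auto simp: W_brownian_bridge_def gaussian_process_def)
  have t: "t \<in> {0..1}" and s: "s \<in> {0..1}" using st by auto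
  have [measurable]: "B0 t \<in> borel_measurable M" "B0 s \<in> borel_measurable M"
    using t s by (auto intro: B0)
  define c where "c = (W t - W s) / W 1"
  have incr: "B t \<omega> - B s \<omega> = (B0 t \<omega> - B0 s \<omega>) + c * B1 \<omega>" if "\<omega> \<in> space M" for \<omega>
    using B[OF t that] B[OF s that] by (simp add: c_def diff_divide_distrib algebra_simps)
  show "(\<lambda>\<omega>. B t \<omega> - B s \<omega>) \<in> borel_measurable M"
    by (subst measurable_cong[OF incr]) auto
  show "distr M borel (\<lambda>\<omega>. B t \<omega> - B s \<omega>) = normal_law 0 (W t - W s)"
  proof (cases "s = t")
    case True
    then show ?thesis by (simp add: normal_law_def)
  next
    case False
    with st have "s < t" by simp
    then have less: "W s < W t" using mono by (rule strict_monoD[rotated])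
    let ?X = "\<lambda>\<omega>. B0 t \<omega> - B0 s \<omega>"
    define v where "v = (W t - W s) - (W t - W s)\<^sup>2 / W 1"
    have v: "0 \<le> v" "distr M borel ?X = normal_law 0 v"
      unfolding v_def
      using W_brownian_bridge_increment[OF \<open>prob_space M\<close> bridge st(1) \<open>s < t\<close> st(3)] by simp_all
    \<comment> \<open>\<open>B1\<close> is independent of the whole bridge, hence of the increment, which is measurable for the
      sigma-algebra that the bridge generates.\<close>
    let ?G = "{B0 r -` A \<inter> space M | r A. r \<in> {0..1} \<and> A \<in> sets borel}"
    let ?S = "sigma (space M) ?G"
    have sub: "?G \<subseteq> Pow (space M)" by auto
    have "B0 r \<in> borel_measurable ?S" if "r \<in> {0..1}" for r
      using that sub by (intro measurableI) (auto simp: space_measure_of sets_measure_of)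
    then have X: "?X \<in> borel_measurable ?S" using s t by (intro borel_measurable_diff)
    have X_sigma: "sigma_sets (space M) {?X -` A \<inter> space M | A. A \<in> sets borel}
        \<subseteq> sigma_sets (space M) ?G"
      using measurable_sets[OF X] sub
      by (intro sigma_sets_mono) (auto simp: space_measure_of sets_measure_of)
    have "indep_set (sigma_sets (space M) {?X -` A \<inter> space M | A. A \<in> sets borel})
        (sigma_sets (space M) {B1 -` A \<inter> space M | A. A \<in> sets borel})"
    proof (rule indep_setI)
      fix a b
      assume "a \<in> sigma_sets (space M) {?X -` A \<inter> space M | A. A \<in> sets borel}"
        and b: "b \<in> sigma_sets (space M) {B1 -` A \<inter> space M | A. A \<in> sets borel}"
      then have "a \<in> sigma_sets (space M) ?G" using X_sigma by blast
      from indep_setD[OF indep b this] show "prob (a \<inter> b) = prob a * prob b"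
        by (simp add: Int_commute mult.commute)
    qed (use X_sigma indep_setD_ev1[OF indep] indep_setD_ev2[OF indep] in auto)
    then have "indep_var borel ?X borel B1" by (simp add: indep_var_eq)
    then have "indep_var borel ((\<lambda>x. x) \<circ> ?X) borel ((*) c \<circ> B1)"
      by (rule indep_var_compose) auto
    then have "distr M borel (\<lambda>\<omega>. ?X \<omega> + c * B1 \<omega>)
        = (distr M borel ?X \<star> distr M borel (\<lambda>\<omega>. c * B1 \<omega>))"
      by (intro sum_indep_random_variable) (auto simp: o_def)
    also have "distr M borel (\<lambda>\<omega>. c * B1 \<omega>) = normal_law 0 (c\<^sup>2 * W 1)"
      using less W1 by (intro distr_scale_normal_law B1_law) (auto simp: c_def)
    also have "(distr M borel ?X \<star> normal_law 0 (c\<^sup>2 * W 1)) = normal_law 0 (v + c\<^sup>2 * W 1)"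
      unfolding v using v W1 by (intro normal_law_convolution) auto
    also have "v + c\<^sup>2 * W 1 = W t - W s"
      using W1 by (simp add: v_def c_def power_divide power2_eq_square)
    also have "distr M borel (\<lambda>\<omega>. ?X \<omega> + c * B1 \<omega>) = distr M borel (\<lambda>\<omega>. B t \<omega> - B s \<omega>)"
      by (rule distr_cong) (auto simp: incr)
    finally show ?thesis .
  qed
qed


section \<open>The semigroup of the increments\<close>

theorem corollary3:
  fixes M :: "'a measure" and W :: "real \<Rightarrow> real" and B :: "real \<Rightarrow> 'a \<Rightarrow> real"
  assumes "prob_space M"
    and "W_function W"
    and "W_brownian_motion M W B"
  shows "(\<forall>s\<in>{0..1}. \<forall>t\<in>{0..1}. s \<le> t \<longrightarrow> (\<forall>f\<in>ess_bounded.
            (\<forall>x. integrable M (\<lambda>\<omega>. f (x + B t \<omega> - B s \<omega>))) \<and>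
            (\<lambda>x. \<integral>\<omega>. f (x + B t \<omega> - B s \<omega>) \<partial>M) \<in> ess_bounded \<and>
            increment_operator M B s t (Linfty f)
              = Linfty (\<lambda>x. \<integral>\<omega>. f (x + B t \<omega> - B s \<omega>) \<partial>M)))
       \<and> two_parameter_markov_semigroup_on {0..1} (increment_operator M B)"
proof -
  interpret prob_space M by fact
  have mono: "strict_mono W" using assms(2) by (simp add: W_function_def)
  let ?\<mu> = "\<lambda>s t. normal_law 0 (W t - W s)"
  have nonneg: "0 \<le> W t - W s" if "s \<le> t" for s t
    using that mono by (simp add: strict_mono_less_eq)
  have prob: "borel_prob_space (?\<mu> s t)" if "s \<le> t" for s t
    using nonneg[OF that] by (rule borel_prob_space_normal_law)
  have law: "distr M borel (\<lambda>\<omega>. B t \<omega> - B s \<omega>) = ?\<mu> s t"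
    and rv: "(\<lambda>\<omega>. B t \<omega> - B s \<omega>) \<in> borel_measurable M"
    if "s \<in> {0..1}" "t \<in> {0..1}" "s \<le> t" for s t
    using W_brownian_motion_increment[OF assms, of s t] that by auto
  have average: "(\<lambda>x. \<integral>\<omega>. f (x + B t \<omega> - B s \<omega>) \<partial>M) = translate_average (?\<mu> s t) f"
    if f: "f \<in> ess_bounded" and st: "s \<in> {0..1}" "t \<in> {0..1}" "s \<le> t" for f s t
  proof -
    note [measurable] = ess_bounded_measurable[OF f] rv[OF st]
    show ?thesis
      unfolding translate_average_def[abs_def] law[OF st, symmetric]
      by (subst integral_distr) (auto simp: add_diff_eq)
  qed
  have operator: "increment_operator M B s t = convolution_operator (?\<mu> s t)"
    if "s \<in> {0..1}" "t \<in> {0..1}" "s \<le> t" for s t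
    unfolding increment_operator_def[abs_def] convolution_operator_def[abs_def]
      average[OF rep_linfty_ess_bounded that] ..
  have integrable: "integrable M (\<lambda>\<omega>. f (x + B t \<omega> - B s \<omega>))"
    if f: "f \<in> ess_bounded" and st: "s \<in> {0..1}" "t \<in> {0..1}" "s \<le> t" for f s t x
  proof (cases "s = t")
    case True
    then show ?thesis by simp
  next
    case False
    note [measurable] = ess_bounded_measurable[OF f] rv[OF st]
    have pos: "0 < W t - W s" using False st mono by (simp add: strict_mono_less)
    obtain C where "AE y in lborel. \<bar>f y\<bar> \<le> C" using f by (rule ess_boundedE)
    from AE_normal_law_translate[OF pos this, where m = 0 and x = x]
    have "AE \<omega> in M. \<bar>f (x + (B t \<omega> - B s \<omega>))\<bar> \<le> C"
      unfolding law[OF st, symmetric] by (rule AE_distrD[rotated]) simp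
    then have "integrable M (\<lambda>\<omega>. f (x + (B t \<omega> - B s \<omega>)))"
      by (intro integrable_const_bound[where B = C]) auto
    then show ?thesis by (simp add: add_diff_eq)
  qed
  have "two_parameter_markov_semigroup_on {0..1} (increment_operator M B)"
    unfolding two_parameter_markov_semigroup_on_def
  proof (intro conjI ballI impI allI)
    fix s t :: real assume st: "s \<in> {0..1}" "t \<in> {0..1}" "s \<le> t"
    interpret inc: borel_prob_space "?\<mu> s t" by (rule prob[OF st(3)])
    show "bounded_linear (increment_operator M B s t)"
      unfolding operator[OF st] by (rule inc.bounded_linear_convolution_operator)
    show "increment_operator M B s t 1 = 1"
      unfolding operator[OF st] by (rule inc.convolution_operator_one)
    show "0 \<le> increment_operator M B s t F" if "0 \<le> F" for F
      unfolding operator[OF st] using that by (rule inc.convolution_operator_nonneg)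
  next
    fix s :: real assume "s \<in> {0..1}"
    then show "increment_operator M B s s = id"
      by (simp add: operator normal_law_def convolution_operator_return_0)
  next
    fix s u t :: real assume s: "s \<in> {0..1}" and u: "u \<in> {0..1}" and t: "t \<in> {0..1}"
      and sut: "s \<le> u \<and> u \<le> t"
    then have le: "s \<le> u" "u \<le> t" "s \<le> t" by auto
    have "(?\<mu> s u \<star> ?\<mu> u t) = ?\<mu> s t"
      using normal_law_convolution[OF le(1,2)[THEN nonneg]] by simp
    then show "increment_operator M B s t = increment_operator M B s u \<circ> increment_operator M B u t"
      using convolution_operator_convolution[OF le(1,2)[THEN prob]]
      by (simp add: operator[OF s t le(3)] operator[OF s u le(1)] operator[OF u t le(2)])
  qed
  moreover have "(\<lambda>x. \<integral>\<omega>. f (x + B t \<omega> - B s \<omega>) \<partial>M) \<in> ess_bounded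
      \<and> increment_operator M B s t (Linfty f) = Linfty (\<lambda>x. \<integral>\<omega>. f (x + B t \<omega> - B s \<omega>) \<partial>M)"
    if "f \<in> ess_bounded" "s \<in> {0..1}" "t \<in> {0..1}" "s \<le> t" for f s t
    using that prob[OF that(4)]
    by (simp add: average operator borel_prob_space.convolution_operator_Linfty
        borel_prob_space.translate_average_ess_bounded)
  ultimately show ?thesis
    by (intro conjI ballI impI allI integrable) simp_all
qed

end
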